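(* Let $N \ge 1$ be an integer and let $\{\gamma_n : n = 1, \ldots, N\}$ be a partition of the unit circle $\partial\mathbb{D}$ into $N$ arcs. For every real number $C < 1$ there is a finite Blaschke product $B$ of degree $N$ such that $\delta(B) > C$ and $B(\gamma_n) = \partial \mathbb{D}$ for every $n = 1, \ldots, N$.
   Context: $\mathbb{D} = \{z \in \mathbb{C} : |z| < 1\}$ is the open unit disk and $\partial\mathbb{D}$ is the unit circle. A finite Blaschke product of degree $N$ is a function $B : \overline{\mathbb{D}} \to \overline{\mathbb{D}}$ of the form $$B(z) = \lambda \prod_{n=1}^N \frac{z - z_n}{1 - \bar z_n z},$$ where $|\lambda| = 1$ and $z_n \in \mathbb{D}$ for $n = 1, \ldots, N$. The uniform separation constant of $B$ is $$\delta(B) = \min_{1 \le k \le N} \prod_{j \neq k} \left| \frac{z_j - z_k}{1 - \bar z_k z_j} \right|$$ (an empty product equals $1$). A partition of the unit circle into $N$ arcs means the following: $N$ distinct points of $\partial\mathbb{D}$ cut the circle into $N$ consecutive arcs of positive length. To make the arcs disjoint, each arc is taken half-open, containing its initial endpoint (in the counterclockwise direction) and not its terminal one. For $N = 1$ the single arc is the whole circle. *)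

theory Defs
  imports "HOL-Analysis.Analysis"
begin

definition finite_blaschke :: "nat \<Rightarrow> complex \<Rightarrow> (nat \<Rightarrow> complex) \<Rightarrow> (complex \<Rightarrow> complex) \<Rightarrow> bool"
  where "finite_blaschke N lam z B \<longleftrightarrow>
    norm lam = 1 \<and> (\<forall>n\<in>{1..N}. z n \<in> ball 0 1) \<and>
    (\<forall>w\<in>cball 0 1. B w = lam * (\<Prod>n=1..N. (w - z n) / (1 - cnj (z n) * w)))"

text \<open>The separation constant is a function of the zeros, listed with multiplicity, so that
  a repeated zero gives the value 0. It is meant for N at least 1.\<close>

definition separation_const :: "nat \<Rightarrow> (nat \<Rightarrow> complex) \<Rightarrow> real"
  where "separation_const N z =
    Min ((\<lambda>k. \<Prod>j\<in>{1..N} - {k}. norm ((z j - z k) / (1 - cnj (z k) * z j))) ` {1..N})"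

text \<open>The N distinct cut points are the points of arguments \<open>\<theta> 0 < \<dots> < \<theta> (N - 1)\<close>, lifted
  to increasing reals within one turn; \<open>\<theta> N\<close> is the first cut point again, one turn later.
  The order in which the arcs are labelled is left arbitrary; as there are N distinct arcs,
  the equation makes \<open>\<gamma>\<close> a bijection from \<open>{1..N}\<close> onto them.\<close>

definition circle_arc_partition :: "nat \<Rightarrow> (nat \<Rightarrow> complex set) \<Rightarrow> bool"
  where "circle_arc_partition N \<gamma> \<longleftrightarrow>
    (\<exists>\<theta>::nat \<Rightarrow> real. strict_mono_on {0..N} \<theta> \<and> \<theta> N = \<theta> 0 + 2 * pi \<and>
      \<gamma> ` {1..N} = (\<lambda>k. cis ` {\<theta> k..<\<theta> (Suc k)}) ` {..<N})"

end

theory Submission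
  imports Defs "HOL-Computational_Algebra.Fundamental_Theorem_Algebra"
begin

text \<open>
  Let \<open>\<zeta>\<^sub>1, \<dots>, \<zeta>\<^sub>N\<close> be the cut points of the circle. For \<open>\<epsilon> > 0\<close> put
  \<open>H(w) = \<Sum>\<^sub>j (w + \<zeta>\<^sub>j) / (w - \<zeta>\<^sub>j)\<close> and \<open>B = (\<epsilon> H + 1) / (\<epsilon> H - 1)\<close>. This \<open>B\<close> is a
  Blaschke product of degree \<open>N\<close> that takes the value 1 at every cut point, and when \<open>\<epsilon>\<close> is
  small its zeros are well separated.

  Boundary values. On the circle \<open>H\<close> is purely imaginary, namely
  \<open>H(cis t) = - \<i> \<Sum>\<^sub>j cot ((t - \<theta>\<^sub>j) / 2)\<close>. Between two consecutive cut points the sum of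
  cotangents runs from \<open>+\<infinity>\<close> to \<open>-\<infinity>\<close>, so it takes every real value (\<open>cot_sum_surj\<close>), and its
  Cayley transform \<open>B\<close> takes every unimodular value other than 1. The value 1 is taken at the
  initial end point of the arc, where \<open>H\<close> has a pole (\<open>cayley_herglotz_image_arc\<close>).

  Zeros. They are the solutions of \<open>\<epsilon> H = -1\<close>, that is, the roots of a polynomial of degree \<open>N\<close>.
  They lie in the open disc because \<open>Re H \<ge> 0\<close> outside it (\<open>roots_perturbed_poly_in_disc\<close>).
  At \<open>\<epsilon> = 0\<close> the polynomial is \<open>\<Prod>\<^sub>j (w - \<zeta>\<^sub>j)\<close>, and as \<open>\<epsilon> \<rightarrow> 0\<close> one root tends to each
  \<open>\<zeta>\<^sub>j\<close> (\<open>tendsto_selected_roots\<close>). So for small \<open>\<epsilon>\<close> there are \<open>N\<close> distinct zeros, one near each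
  of \<open>N\<close> distinct points of the circle. As
  \<open>\<bar>a - b\<bar> = \<bar>1 - cnj b * a\<bar>\<close> for unimodular \<open>a\<close> and \<open>b\<close>, the separation constant tends to 1
  (\<open>ex_separated_roots\<close>).

  That the Blaschke product with these zeros is \<open>B\<close> on the circle is seen by reflecting the
  polynomial in the circle. There \<open>cnj H = -H\<close>, so the reflection is, up to a constant factor,
  the polynomial with \<open>-\<epsilon>\<close> in place of \<open>\<epsilon>\<close>, which is the denominator of \<open>B\<close>
  (\<open>blaschke_eq_cayley_herglotz\<close>).
\<close>

section \<open>A root of a polynomial near a point where the polynomial is small\<close>

text \<open>If \<open>p = L (X - z\<^sub>1) \<dots> (X - z\<^sub>n)\<close> then \<open>\<bar>p x\<bar> = \<bar>L\<bar> \<bar>x - z\<^sub>1\<bar> \<dots> \<bar>x - z\<^sub>n\<bar>\<close>. Read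
  contrapositively, a small value at \<open>x\<close> forces a root near \<open>x\<close>. This locates roots without
  counting multiplicities.\<close>
lemma norm_poly_ge_if_roots_far:
  fixes p :: "complex poly"
  assumes "p \<noteq> 0" "r \<ge> 0" "\<And>z. poly p z = 0 \<Longrightarrow> r \<le> norm (x - z)"
  shows "norm (lead_coeff p) * r ^ degree p \<le> norm (poly p x)"
  using assms
proof (induction "degree p" arbitrary: p)
  case 0
  then obtain c where "p = [:c:]"
    by (metis degree_eq_zeroE)
  then show ?case by simp
next
  case (Suc n)
  then have "\<not> constant (poly p)"
    by (simp add: constant_degree)
  then obtain z where z: "poly p z = 0"
    using fundamental_theorem_of_algebra by blast
  then obtain q where q: "p = [:-z, 1:] * q"
    by (metis dvdE poly_eq_0_iff_dvd)
  have q0: "q \<noteq> 0"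
    using Suc.prems(1) q by auto
  have deg: "degree p = Suc (degree q)"
    unfolding q using q0 by (subst degree_mult_eq) auto
  have lead: "lead_coeff p = lead_coeff q"
    unfolding q lead_coeff_mult by simp
  have "norm (lead_coeff q) * r ^ degree q \<le> norm (poly q x)"
    using Suc.hyps(1)[of q] Suc.hyps(2) deg q0 Suc.prems q by simp
  moreover have "r \<le> norm (x - z)"
    using Suc.prems(3) z by blast
  ultimately have "r * (norm (lead_coeff q) * r ^ degree q) \<le> norm (x - z) * norm (poly q x)"
    using Suc.prems(2) by (intro mult_mono) auto
  moreover have "norm (poly p x) = norm (x - z) * norm (poly q x)"
    unfolding q by (simp add: norm_mult flip: left_diff_distrib)
  moreover have "norm (lead_coeff p) * r ^ degree p = r * (norm (lead_coeff q) * r ^ degree q)"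
    unfolding lead by (simp add: deg)
  ultimately show ?case by simp
qed

section \<open>The Herglotz sum with poles at given points of the circle\<close>

definition node_poly :: "('a \<Rightarrow> complex) \<Rightarrow> 'a set \<Rightarrow> complex poly"
  where "node_poly \<zeta> A = (\<Prod>j\<in>A. [:- \<zeta> j, 1:])"

text \<open>The product of \<open>node_poly \<zeta> A\<close> with the Herglotz sum
  \<open>\<Sum>k\<in>A. (w + \<zeta> k) / (w - \<zeta> k)\<close>, which clears the denominators.\<close>
definition herglotz_poly :: "('a \<Rightarrow> complex) \<Rightarrow> 'a set \<Rightarrow> complex poly"
  where "herglotz_poly \<zeta> A = (\<Sum>k\<in>A. [:\<zeta> k, 1:] * node_poly \<zeta> (A - {k}))"

text \<open>Its roots are the solutions of \<open>\<epsilon> H = -1\<close>, where \<open>H\<close> is the Herglotz sum; they will be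
  the zeros of the Blaschke product.\<close>
definition perturbed_poly :: "('a \<Rightarrow> complex) \<Rightarrow> 'a set \<Rightarrow> real \<Rightarrow> complex poly"
  where "perturbed_poly \<zeta> A \<epsilon> = node_poly \<zeta> A + smult (of_real \<epsilon>) (herglotz_poly \<zeta> A)"

lemma poly_node_poly: "poly (node_poly \<zeta> A) w = (\<Prod>j\<in>A. w - \<zeta> j)"
  by (simp add: node_poly_def poly_prod)

lemma poly_herglotz_poly:
  "poly (herglotz_poly \<zeta> A) w = (\<Sum>k\<in>A. (w + \<zeta> k) * (\<Prod>j\<in>A - {k}. w - \<zeta> j))"
  by (simp add: herglotz_poly_def poly_sum poly_node_poly algebra_simps)

lemma poly_perturbed_poly:
  "poly (perturbed_poly \<zeta> A \<epsilon>) w =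
    poly (node_poly \<zeta> A) w + of_real \<epsilon> * poly (herglotz_poly \<zeta> A) w"
  by (simp add: perturbed_poly_def)

lemma degree_node_poly: "degree (node_poly \<zeta> A) = card A"
  by (cases "finite A") (simp_all add: node_poly_def degree_prod_eq_sum_degree)

lemma lead_coeff_node_poly: "lead_coeff (node_poly \<zeta> A) = 1"
  by (simp add: node_poly_def lead_coeff_prod)

lemma herglotz_summand_top:
  assumes "finite A" "k \<in> A"
  shows "degree ([:\<zeta> k, 1:] * node_poly \<zeta> (A - {k})) = card A"
    and "coeff ([:\<zeta> k, 1:] * node_poly \<zeta> (A - {k})) (card A) = 1"
proof -
  have "node_poly \<zeta> (A - {k}) \<noteq> 0"
    using lead_coeff_node_poly[of \<zeta> "A - {k}"] by force
  then show deg: "degree ([:\<zeta> k, 1:] * node_poly \<zeta> (A - {k})) = card A"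
    using assms
    by (subst degree_mult_eq) (auto simp: degree_node_poly card_Suc_Diff1 simp del: card_Diff_insert)
  have "lead_coeff ([:\<zeta> k, 1:] * node_poly \<zeta> (A - {k})) = 1"
    by (simp only: lead_coeff_mult lead_coeff_node_poly) simp
  then show "coeff ([:\<zeta> k, 1:] * node_poly \<zeta> (A - {k})) (card A) = 1"
    by (simp only: deg)
qed

lemma degree_perturbed_poly_le:
  assumes "finite A"
  shows "degree (perturbed_poly \<zeta> A \<epsilon>) \<le> card A"
proof -
  have "degree (herglotz_poly \<zeta> A) \<le> card A"
    unfolding herglotz_poly_def using assms
    by (intro degree_sum_le) (auto simp: herglotz_summand_top(1) simp del: mult_pCons_left)
  then show ?thesis
    unfolding perturbed_poly_def
    by (intro degree_add_le) (auto simp: degree_node_poly intro: order.trans[OF degree_smult_le])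
qed

lemma coeff_perturbed_poly:
  assumes "finite A"
  shows "coeff (perturbed_poly \<zeta> A \<epsilon>) (card A) = of_real (1 + \<epsilon> * card A)"
proof -
  have "coeff (herglotz_poly \<zeta> A) (card A) = of_nat (card A)"
    unfolding herglotz_poly_def coeff_sum using assms
    by (simp add: herglotz_summand_top(2) del: mult_pCons_left)
  moreover have "coeff (node_poly \<zeta> A) (card A) = 1"
    using lead_coeff_node_poly[of \<zeta> A] by (simp only: degree_node_poly)
  ultimately show ?thesis
    by (simp add: perturbed_poly_def)
qed

lemma degree_perturbed_poly:
  assumes "finite A" "\<epsilon> > 0"
  shows "degree (perturbed_poly \<zeta> A \<epsilon>) = card A"
proof (rule antisym)
  have "(0::real) < 1 + \<epsilon> * card A"
    using assms by (intro add_pos_nonneg) auto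
  then have "coeff (perturbed_poly \<zeta> A \<epsilon>) (card A) \<noteq> 0"
    by (simp only: coeff_perturbed_poly[OF assms(1)] of_real_eq_0_iff)
  then show "card A \<le> degree (perturbed_poly \<zeta> A \<epsilon>)"
    by (rule le_degree)
qed (rule degree_perturbed_poly_le[OF assms(1)])

lemma poly_node_poly_node:
  assumes "finite A" "k \<in> A"
  shows "poly (node_poly \<zeta> A) (\<zeta> k) = 0"
  using assms by (auto simp: poly_node_poly)

lemma poly_herglotz_poly_node:
  assumes "finite A" "k \<in> A" "inj_on \<zeta> A" "\<zeta> k \<noteq> 0"
  shows "poly (herglotz_poly \<zeta> A) (\<zeta> k) \<noteq> 0"
proof -
  have "(\<Prod>j\<in>A - {i}. \<zeta> k - \<zeta> j) = 0" if "i \<in> A - {k}" for i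
    using assms that by (intro prod_zero) auto
  then have "(\<Sum>i\<in>A - {k}. (\<zeta> k + \<zeta> i) * (\<Prod>j\<in>A - {i}. \<zeta> k - \<zeta> j)) = 0"
    by (intro sum.neutral) simp
  then have "poly (herglotz_poly \<zeta> A) (\<zeta> k) = (\<zeta> k + \<zeta> k) * (\<Prod>j\<in>A - {k}. \<zeta> k - \<zeta> j)"
    unfolding poly_herglotz_poly using assms
    by (simp add: sum.remove[of A k])
  also have "\<dots> \<noteq> 0"
    using assms by (auto simp: inj_on_def)
  finally show ?thesis .
qed

lemma poly_herglotz_poly_eq:
  assumes "finite A" "w \<notin> \<zeta> ` A"
  shows "poly (herglotz_poly \<zeta> A) w =
    poly (node_poly \<zeta> A) w * (\<Sum>k\<in>A. (w + \<zeta> k) / (w - \<zeta> k))"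
proof -
  have "(w + \<zeta> k) * (\<Prod>j\<in>A - {k}. w - \<zeta> j) = (\<Prod>j\<in>A. w - \<zeta> j) * ((w + \<zeta> k) / (w - \<zeta> k))"
    if "k \<in> A" for k
    using assms that by (subst prod.remove[of A k]) auto
  then show ?thesis
    unfolding poly_herglotz_poly poly_node_poly sum_distrib_left by (rule sum.cong[OF refl])
qed

text \<open>The real part is \<open>(\<bar>w\<bar>\<^sup>2 - \<bar>\<zeta>\<bar>\<^sup>2) / \<bar>w - \<zeta>\<bar>\<^sup>2\<close>, the Poisson kernel up to sign.\<close>
lemma Re_herglotz_kernel_nonneg:
  fixes w \<zeta> :: complex
  assumes "norm \<zeta> \<le> norm w"
  shows "Re ((w + \<zeta>) / (w - \<zeta>)) \<ge> 0"
proof -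
  have "(norm \<zeta>)\<^sup>2 \<le> (norm w)\<^sup>2"
    using assms by (simp add: power_mono)
  then have "(Re \<zeta>)\<^sup>2 + (Im \<zeta>)\<^sup>2 \<le> (Re w)\<^sup>2 + (Im w)\<^sup>2"
    by (simp add: cmod_power2)
  then have "0 \<le> Re (w + \<zeta>) * Re (w - \<zeta>) + Im (w + \<zeta>) * Im (w - \<zeta>)"
    by (simp add: algebra_simps power2_eq_square)
  then show ?thesis
    by (simp only: Re_divide) simp
qed

text \<open>A root is a point where the Herglotz sum equals \<open>-1 / \<epsilon>\<close>, whereas outside the open disc
  each summand has nonnegative real part.\<close>
lemma roots_perturbed_poly_in_disc:
  assumes "finite A" "inj_on \<zeta> A" "\<And>j. j \<in> A \<Longrightarrow> norm (\<zeta> j) = 1" "\<epsilon> > 0"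
    and root: "poly (perturbed_poly \<zeta> A \<epsilon>) z = 0"
  shows "norm z < 1"
proof (rule ccontr)
  assume outside: "\<not> norm z < 1"
  have "poly (perturbed_poly \<zeta> A \<epsilon>) (\<zeta> k) \<noteq> 0" if "k \<in> A" for k
  proof -
    have "\<zeta> k \<noteq> 0"
      using assms(3)[OF that] by force
    then show ?thesis
      using poly_herglotz_poly_node[OF assms(1) that assms(2)] assms(4)
        poly_node_poly_node[OF assms(1) that] by (simp add: poly_perturbed_poly)
  qed
  then have notin: "z \<notin> \<zeta> ` A"
    using root by auto
  define S where "S = (\<Sum>k\<in>A. (z + \<zeta> k) / (z - \<zeta> k))"
  have "Re S \<ge> 0"
    unfolding S_def Re_sum using outside assms(3)
    by (intro sum_nonneg Re_herglotz_kernel_nonneg) auto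
  have "poly (node_poly \<zeta> A) z \<noteq> 0"
    using notin assms(1) by (auto simp: poly_node_poly)
  moreover have "poly (node_poly \<zeta> A) z * (1 + of_real \<epsilon> * S) = 0"
    using root unfolding poly_perturbed_poly poly_herglotz_poly_eq[OF assms(1) notin] S_def
    by (simp add: algebra_simps)
  ultimately have "1 + of_real \<epsilon> * S = 0"
    by simp
  then have "Re (1 + of_real \<epsilon> * S) = 0"
    by (simp only: zero_complex.sel)
  then have "1 + \<epsilon> * Re S = 0"
    by simp
  then show False
    using \<open>Re S \<ge> 0\<close> assms(4) by (simp add: add_nonneg_eq_0_iff)
qed

text \<open>At the node \<open>\<zeta> k\<close> the polynomial has a value of size \<open>O(\<epsilon>)\<close>, while its leading coefficient
  stays at least 1 in modulus. So some root is within \<open>O(\<epsilon>\<^bsup>1/N\<^esup>)\<close> of \<open>\<zeta> k\<close>.\<close>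
lemma tendsto_selected_roots:
  assumes "finite A" "k \<in> A"
  shows "\<exists>z. (\<forall>\<epsilon>>0. poly (perturbed_poly \<zeta> A \<epsilon>) (z \<epsilon>) = 0) \<and> (z \<longlongrightarrow> \<zeta> k) (at_right 0)"
proof -
  define N where "N = card A"
  \<comment> \<open>The summand 1 makes the inequality strict that contradicts the lower bound for the value
    at the node.\<close>
  define M where "M = norm (poly (herglotz_poly \<zeta> A) (\<zeta> k)) + 1"
  define r where "r = (\<lambda>\<epsilon>::real. root N (\<epsilon> * M))"
  have N: "N > 0"
    using assms by (auto simp: N_def card_gt_0_iff)
  have M: "M > 0"
    unfolding M_def by (simp add: add_nonneg_pos)
  have "\<exists>z. poly (perturbed_poly \<zeta> A \<epsilon>) z = 0 \<and> norm (\<zeta> k - z) < r \<epsilon>" if "\<epsilon> > 0" for \<epsilon>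
  proof (rule ccontr)
    assume "\<not> ?thesis"
    then have far: "r \<epsilon> \<le> norm (\<zeta> k - z)" if "poly (perturbed_poly \<zeta> A \<epsilon>) z = 0" for z
      using that by force
    have deg: "degree (perturbed_poly \<zeta> A \<epsilon>) = N"
      using degree_perturbed_poly[OF assms(1) that] by (simp add: N_def)
    have "perturbed_poly \<zeta> A \<epsilon> \<noteq> 0"
      using deg N by force
    moreover have "0 \<le> r \<epsilon>"
      using that M N by (simp add: r_def real_root_ge_zero)
    moreover have pow: "r \<epsilon> ^ N = \<epsilon> * M"
      using N that M by (simp add: r_def)
    moreover have lead: "norm (lead_coeff (perturbed_poly \<zeta> A \<epsilon>)) = 1 + \<epsilon> * N"
    proof -
      have "lead_coeff (perturbed_poly \<zeta> A \<epsilon>) = of_real (1 + \<epsilon> * N)"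
        unfolding deg using coeff_perturbed_poly[OF assms(1)] by (simp add: N_def)
      then show ?thesis
        using that by (simp only: norm_of_real) simp
    qed
    ultimately have "(1 + \<epsilon> * N) * (\<epsilon> * M) \<le> norm (poly (perturbed_poly \<zeta> A \<epsilon>) (\<zeta> k))"
      using norm_poly_ge_if_roots_far[of "perturbed_poly \<zeta> A \<epsilon>" "r \<epsilon>" "\<zeta> k"] far deg by metis
    also have "\<dots> = \<epsilon> * (M - 1)"
      using that poly_node_poly_node[OF assms]
      by (simp add: poly_perturbed_poly norm_mult M_def)
    also have "\<dots> < \<epsilon> * M"
      using that by simp
    also have "\<dots> \<le> (1 + \<epsilon> * N) * (\<epsilon> * M)"
      using that M by (simp add: algebra_simps)
    finally show False by simp
  qed
  then obtain z where z: "\<And>\<epsilon>. \<epsilon> > 0 \<Longrightarrow> poly (perturbed_poly \<zeta> A \<epsilon>) (z \<epsilon>) = 0"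
      "\<And>\<epsilon>. \<epsilon> > 0 \<Longrightarrow> norm (\<zeta> k - z \<epsilon>) < r \<epsilon>"
    by metis
  have "(r \<longlongrightarrow> root N (0 * M)) (at_right 0)"
    unfolding r_def by (intro tendsto_intros)
  then have r0: "(r \<longlongrightarrow> 0) (at_right 0)"
    by simp
  have "((\<lambda>\<epsilon>. z \<epsilon> - \<zeta> k) \<longlongrightarrow> 0) (at_right 0)"
  proof (rule Lim_null_comparison[OF _ r0])
    show "\<forall>\<^sub>F \<epsilon> in at_right 0. norm (z \<epsilon> - \<zeta> k) \<le> r \<epsilon>"
      using eventually_at_right_less[of "0::real"]
      by eventually_elim (use z(2) in \<open>force simp: norm_minus_commute\<close>)
  qed
  then have "(z \<longlongrightarrow> \<zeta> k) (at_right 0)"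
    by (simp add: LIM_zero_iff)
  with z(1) show ?thesis by blast
qed

text \<open>The degree is at most \<open>card A\<close>, so \<open>card A\<close> distinct roots and the top coefficient determine
  the polynomial.\<close>
lemma perturbed_poly_factor:
  assumes "finite A" "inj_on z A" "\<And>j. j \<in> A \<Longrightarrow> poly (perturbed_poly \<zeta> A \<epsilon>) (z j) = 0"
  shows "poly (perturbed_poly \<zeta> A \<epsilon>) w = of_real (1 + \<epsilon> * card A) * (\<Prod>j\<in>A. w - z j)"
proof -
  have "perturbed_poly \<zeta> A \<epsilon> = smult (of_real (1 + \<epsilon> * card A)) (node_poly z A)"
  proof (rule poly_eqI_degree_lead_coeff[where n = "card A" and A = "z ` A"])
    show "coeff (perturbed_poly \<zeta> A \<epsilon>) (card A) =
        coeff (smult (of_real (1 + \<epsilon> * card A)) (node_poly z A)) (card A)"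
      using lead_coeff_node_poly[of z A] assms(1)
      by (simp add: coeff_perturbed_poly degree_node_poly)
    show "degree (smult (of_real (1 + \<epsilon> * card A)) (node_poly z A)) \<le> card A"
      using degree_smult_le[of "of_real (1 + \<epsilon> * card A)" "node_poly z A"]
      by (simp only: degree_node_poly)
    show "poly (perturbed_poly \<zeta> A \<epsilon>) x =
        poly (smult (of_real (1 + \<epsilon> * card A)) (node_poly z A)) x" if "x \<in> z ` A" for x
      using that assms poly_node_poly_node[OF assms(1)] by auto
  qed (use assms in \<open>simp_all add: card_image degree_perturbed_poly_le\<close>)
  then show ?thesis
    by (simp add: poly_node_poly)
qed

section \<open>Reflection in the circle\<close>

lemma circle_mult_cnj_diff:
  assumes "norm w = 1"
  shows "w * cnj (w - a) = 1 - cnj a * w"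
proof -
  have "w * cnj w = 1"
    using assms complex_norm_square[of w] by simp
  then show ?thesis
    by (simp add: algebra_simps)
qed

lemma circle_mult_cnj_diff_node:
  assumes "norm w = 1" "norm a = 1"
  shows "w * cnj (w - a) = - cnj a * (w - a)" "w * cnj (w + a) = cnj a * (w + a)"
proof -
  have "w * cnj w = 1" "a * cnj a = 1"
    using assms complex_norm_square[of w] complex_norm_square[of a] by simp_all
  then show "w * cnj (w - a) = - cnj a * (w - a)" "w * cnj (w + a) = cnj a * (w + a)"
    by (simp_all add: algebra_simps)
qed

text \<open>Under \<open>p \<mapsto> w\<^bsup>n\<^esup> cnj (p w)\<close>, which on the circle is the passage to the reciprocal polynomial,
  the node polynomial and the Herglotz polynomial are eigenvectors with opposite eigenvalues. The
  sign differs because each summand of the latter has one factor \<open>w + \<zeta> k\<close> in place of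
  \<open>w - \<zeta> k\<close>.\<close>
lemma node_poly_reflect:
  assumes "norm w = 1" "\<And>j. j \<in> A \<Longrightarrow> norm (\<zeta> j) = 1"
  shows "w ^ card A * cnj (poly (node_poly \<zeta> A) w) =
    (\<Prod>j\<in>A. - cnj (\<zeta> j)) * poly (node_poly \<zeta> A) w"
proof -
  have "w ^ card A * cnj (poly (node_poly \<zeta> A) w) = (\<Prod>j\<in>A. w * cnj (w - \<zeta> j))"
    by (simp add: poly_node_poly prod.distrib)
  also have "\<dots> = (\<Prod>j\<in>A. - cnj (\<zeta> j) * (w - \<zeta> j))"
    using circle_mult_cnj_diff_node(1) assms by (intro prod.cong) auto
  finally show ?thesis
    by (simp only: prod.distrib poly_node_poly)
qed

lemma herglotz_poly_reflect:
  assumes "finite A" "norm w = 1" "\<And>j. j \<in> A \<Longrightarrow> norm (\<zeta> j) = 1"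
  shows "w ^ card A * cnj (poly (herglotz_poly \<zeta> A) w) =
    - (\<Prod>j\<in>A. - cnj (\<zeta> j)) * poly (herglotz_poly \<zeta> A) w"
proof -
  have "w ^ card A * cnj ((w + \<zeta> k) * poly (node_poly \<zeta> (A - {k})) w) =
      - (\<Prod>j\<in>A. - cnj (\<zeta> j)) * ((w + \<zeta> k) * poly (node_poly \<zeta> (A - {k})) w)"
    if k: "k \<in> A" for k
  proof -
    have "card A = Suc (card (A - {k}))"
      using assms(1) k by (rule card.remove)
    then have "w ^ card A * cnj ((w + \<zeta> k) * poly (node_poly \<zeta> (A - {k})) w) =
        (w * cnj (w + \<zeta> k)) * (w ^ card (A - {k}) * cnj (poly (node_poly \<zeta> (A - {k})) w))"
      by (simp only: power_Suc complex_cnj_mult mult_ac)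
    also have "\<dots> = (cnj (\<zeta> k) * (w + \<zeta> k)) *
        ((\<Prod>j\<in>A - {k}. - cnj (\<zeta> j)) * poly (node_poly \<zeta> (A - {k})) w)"
      using circle_mult_cnj_diff_node(2)[OF assms(2) assms(3)[OF k]]
        node_poly_reflect[OF assms(2), of "A - {k}" \<zeta>] assms(3) by simp
    also have "\<dots> = - (\<Prod>j\<in>A. - cnj (\<zeta> j)) * ((w + \<zeta> k) * poly (node_poly \<zeta> (A - {k})) w)"
      unfolding prod.remove[OF assms(1) k] by simp
    finally show ?thesis .
  qed
  then show ?thesis
    unfolding poly_herglotz_poly poly_node_poly cnj_sum sum_distrib_left
    by (intro sum.cong) auto
qed

text \<open>The numerators \<open>w - z j\<close> multiply to \<open>P + Q\<close> up to the factor \<open>L = 1 + \<epsilon> card A\<close>, and the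
  denominators \<open>1 - cnj (z j) * w = w * cnj (w - z j)\<close> multiply to its reflection
  \<open>\<kappa> (P - Q)\<close> up to the same factor. Multiplication by \<open>-\<kappa>\<close> normalises the quotient to take the
  value 1 at the nodes, where \<open>P\<close> vanishes. The formula is stated without dividing by \<open>P\<close>, so
  that it covers the nodes too.\<close>
lemma blaschke_eq_cayley_herglotz:
  assumes "finite A" "\<And>j. j \<in> A \<Longrightarrow> norm (\<zeta> j) = 1" "\<epsilon> > 0"
    and "\<And>j. j \<in> A \<Longrightarrow> norm (z j) < 1"
    and "inj_on z A" "\<And>j. j \<in> A \<Longrightarrow> poly (perturbed_poly \<zeta> A \<epsilon>) (z j) = 0"
    and "norm w = 1"
  defines "P \<equiv> poly (node_poly \<zeta> A) w" and "Q \<equiv> of_real \<epsilon> * poly (herglotz_poly \<zeta> A) w"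
  shows "P - Q \<noteq> 0"
    and "- (\<Prod>j\<in>A. - cnj (\<zeta> j)) * (\<Prod>j\<in>A. (w - z j) / (1 - cnj (z j) * w)) = (Q + P) / (Q - P)"
proof -
  define \<kappa> where "\<kappa> = (\<Prod>j\<in>A. - cnj (\<zeta> j))"
  define L where "L = 1 + \<epsilon> * card A"
  have L: "L > 0"
    unfolding L_def using assms(3) by (intro add_pos_nonneg) auto
  have \<kappa>: "\<kappa> \<noteq> 0"
    unfolding \<kappa>_def using assms(1,2) by force
  have num: "P + Q = of_real L * (\<Prod>j\<in>A. w - z j)"
    using perturbed_poly_factor[OF assms(1,5,6), of w]
    by (simp add: poly_perturbed_poly P_def Q_def L_def)
  have "of_real L * (\<Prod>j\<in>A. 1 - cnj (z j) * w) = of_real L * (\<Prod>j\<in>A. w * cnj (w - z j))"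
    using circle_mult_cnj_diff[OF assms(7)] by simp
  also have "\<dots> = w ^ card A * cnj (P + Q)"
    unfolding num by (simp add: prod.distrib)
  also have "\<dots> = \<kappa> * (P - Q)"
    using node_poly_reflect[OF assms(7), of A \<zeta>] herglotz_poly_reflect[OF assms(1) assms(7), of \<zeta>]
      assms(2) by (simp add: P_def Q_def \<kappa>_def algebra_simps)
  finally have den: "of_real L * (\<Prod>j\<in>A. 1 - cnj (z j) * w) = \<kappa> * (P - Q)" .
  have "1 - cnj (z j) * w \<noteq> 0" if "j \<in> A" for j
  proof
    assume "1 - cnj (z j) * w = 0"
    then have "norm (cnj (z j) * w) = 1"
      by (metis eq_iff_diff_eq_0 norm_one)
    then show False
      using assms(4)[OF that] assms(7) by (simp add: norm_mult)
  qed
  then have "(\<Prod>j\<in>A. 1 - cnj (z j) * w) \<noteq> 0"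
    using assms(1) by simp
  then show PQ: "P - Q \<noteq> 0"
    using den L \<kappa> by (metis mult_eq_0_iff of_real_eq_0_iff less_irrefl)
  have "(\<Prod>j\<in>A. (w - z j) / (1 - cnj (z j) * w)) = (P + Q) / (\<kappa> * (P - Q))"
    unfolding den[symmetric] num using L by (simp add: prod_dividef)
  moreover have "Q - P \<noteq> 0"
    using PQ by simp
  ultimately show "- (\<Prod>j\<in>A. - cnj (\<zeta> j)) * (\<Prod>j\<in>A. (w - z j) / (1 - cnj (z j) * w)) =
      (Q + P) / (Q - P)"
    unfolding \<kappa>_def[symmetric] using \<kappa> PQ by (simp add: divide_simps) (simp add: algebra_simps)
qed

section \<open>Sums of cotangents\<close>

lemma cot_add_root_sin:
  fixes x y :: real
  assumes "sin y = 0"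
  shows "cot (x + y) = cot x"
proof -
  have "cos y \<noteq> 0"
    using assms sin_zero_abs_cos_one by fastforce
  then show ?thesis
    using assms by (simp add: cot_def sin_add cos_add)
qed

lemma filterlim_cot_half_right: "filterlim (\<lambda>t::real. cot ((t - l) / 2)) at_top (at_right l)"
  unfolding cot_def
proof (rule LIM_at_top_divide)
  have "((\<lambda>t. cos ((t - l) / 2)) \<longlongrightarrow> cos ((l - l) / 2)) (at_right l)"
    by (intro tendsto_intros) auto
  then show "((\<lambda>t. cos ((t - l) / 2)) \<longlongrightarrow> 1) (at_right l)"
    by simp
  have "((\<lambda>t. sin ((t - l) / 2)) \<longlongrightarrow> sin ((l - l) / 2)) (at_right l)"
    by (intro tendsto_intros) auto
  then show "((\<lambda>t. sin ((t - l) / 2)) \<longlongrightarrow> 0) (at_right l)"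
    by simp
  have "\<forall>\<^sub>F t in at_right l. t \<in> {l<..<l + 2 * pi}"
    by (intro eventually_at_right_real) auto
  then show "\<forall>\<^sub>F t in at_right l. 0 < sin ((t - l) / 2)"
    by eventually_elim (auto intro!: sin_gt_zero)
qed auto

lemma filterlim_cot_half_left: "filterlim (\<lambda>t::real. cot ((t - r) / 2)) at_bot (at_left r)"
proof -
  have "cot ((- t - r) / 2) = - cot ((t - (- r)) / 2)" for t :: real
    using cot_minus[of "(t - (- r)) / 2"] by (simp only: minus_divide_left) simp
  then have "filterlim (\<lambda>t. cot ((- t - r) / 2)) at_bot (at_right (- r))"
    using filterlim_cot_half_right[of "- r"] by (simp only: filterlim_uminus_at_bot) simp
  then show ?thesis
    by (subst filterlim_at_left_to_right)
qed

text \<open>The interval \<open>{l<..<r}\<close> is a gap between consecutive poles. At each end exactly one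
  summand is singular; it sends the sum to \<open>+\<infinity>\<close> at \<open>l\<close> and to \<open>-\<infinity>\<close> at \<open>r\<close>, and the intermediate
  value theorem does the rest. The singular summand at \<open>l\<close> is characterised by a zero of the sine
  and not by \<open>a p = l\<close>, since on the circle the pole may be represented by an angle that differs
  from \<open>l\<close> by a full turn.\<close>
lemma cot_sum_surj:
  fixes a :: "'a \<Rightarrow> real"
  assumes A: "finite A" and "l < r"
    and p: "p \<in> A" "sin ((l - a p) / 2) = 0" "\<And>j. j \<in> A - {p} \<Longrightarrow> sin ((l - a j) / 2) \<noteq> 0"
    and q: "q \<in> A" "sin ((r - a q) / 2) = 0" "\<And>j. j \<in> A - {q} \<Longrightarrow> sin ((r - a j) / 2) \<noteq> 0"
    and inside: "\<And>t j. t \<in> {l<..<r} \<Longrightarrow> j \<in> A \<Longrightarrow> sin ((t - a j) / 2) \<noteq> 0"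
  shows "\<exists>t\<in>{l<..<r}. (\<Sum>j\<in>A. cot ((t - a j) / 2)) = y"
proof -
  define G where "G = (\<lambda>t. \<Sum>j\<in>A. cot ((t - a j) / 2))"
  \<comment> \<open>By periodicity the singular summand can be replaced by the one centred at the end point.\<close>
  have split: "G = (\<lambda>t. (\<Sum>j\<in>A - {m}. cot ((t - a j) / 2)) + cot ((t - e) / 2))"
    if "m \<in> A" "sin ((e - a m) / 2) = 0" for m e
  proof
    fix t
    have "cot ((t - a m) / 2) = cot ((t - e) / 2)"
      using cot_add_root_sin[OF that(2), of "(t - e) / 2"] by (simp add: field_simps)
    then show "G t = (\<Sum>j\<in>A - {m}. cot ((t - a j) / 2)) + cot ((t - e) / 2)"
      unfolding G_def using A that(1) by (simp add: sum.remove[of A m])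
  qed
  have "((\<lambda>t. \<Sum>j\<in>A - {p}. cot ((t - a j) / 2)) \<longlongrightarrow> (\<Sum>j\<in>A - {p}. cot ((l - a j) / 2)))
      (at_right l)"
    using p(3) by (intro tendsto_intros) auto
  then have "filterlim G at_top (at_right l)"
    unfolding split[OF p(1,2)]
    by (rule filterlim_tendsto_add_at_top) (rule filterlim_cot_half_right)
  then have "\<forall>\<^sub>F t in at_right l. y \<le> G t"
    by (simp add: filterlim_at_top)
  moreover have "\<forall>\<^sub>F t in at_right l. t \<in> {l<..<(l + r) / 2}"
    using \<open>l < r\<close> by (intro eventually_at_right_real) simp
  ultimately have "\<forall>\<^sub>F t in at_right l. y \<le> G t \<and> t \<in> {l<..<(l + r) / 2}"
    by (rule eventually_conj)
  then obtain s where s: "y \<le> G s" "s \<in> {l<..<(l + r) / 2}"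
    using eventually_happens'[OF trivial_limit_at_right_real] by blast
  have "((\<lambda>t. \<Sum>j\<in>A - {q}. cot ((t - a j) / 2)) \<longlongrightarrow> (\<Sum>j\<in>A - {q}. cot ((r - a j) / 2)))
      (at_left r)"
    using q(3) by (intro tendsto_intros) auto
  then have "filterlim G at_bot (at_left r)"
    unfolding split[OF q(1,2)]
    using filterlim_cot_half_left by (simp only: filterlim_tendsto_add_at_bot_iff)
  then have "\<forall>\<^sub>F t in at_left r. G t \<le> y"
    by (simp add: filterlim_at_bot)
  moreover have "\<forall>\<^sub>F t in at_left r. t \<in> {(l + r) / 2<..<r}"
    using \<open>l < r\<close> by (intro eventually_at_left_real) simp
  ultimately have "\<forall>\<^sub>F t in at_left r. G t \<le> y \<and> t \<in> {(l + r) / 2<..<r}"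
    by (rule eventually_conj)
  then obtain u where u: "G u \<le> y" "u \<in> {(l + r) / 2<..<r}"
    using eventually_happens'[OF trivial_limit_at_left_real] by blast
  have "continuous_on {s..u} G"
    unfolding G_def
  proof (intro continuous_on_sum ballI)
    fix j assume "j \<in> A"
    then have "sin ((t - a j) / 2) \<noteq> 0" if "t \<in> {s..u}" for t
      using inside[of t j] s(2) u(2) that by auto
    then show "continuous_on {s..u} (\<lambda>t. cot ((t - a j) / 2))"
      unfolding cot_def by (intro continuous_intros) auto
  qed
  then obtain t where "s \<le> t" "t \<le> u" "G t = y"
    using IVT2'[of G u y s] s u by auto
  then show ?thesis
    using s(2) u(2) unfolding G_def by (intro bexI[of _ t]) auto
qed

section \<open>Boundary values\<close>

text \<open>With \<open>u = cis ((t - a) / 2)\<close> and \<open>m = cis ((t + a) / 2)\<close> one has \<open>cis t = u * m\<close> and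
  \<open>cis a = cnj u * m\<close>.\<close>
lemma cis_add_diff_half_angle:
  "cis t + cis a = 2 * of_real (cos ((t - a) / 2)) * cis ((t + a) / 2)"
  "cis t - cis a = 2 * \<i> * of_real (sin ((t - a) / 2)) * cis ((t + a) / 2)"
proof -
  have "cis t = cis ((t - a) / 2) * cis ((t + a) / 2)"
    by (simp add: cis_mult flip: add_divide_distrib)
  moreover have "cis a = cnj (cis ((t - a) / 2)) * cis ((t + a) / 2)"
    by (simp add: cis_cnj cis_mult field_simps)
  ultimately show
    "cis t + cis a = 2 * of_real (cos ((t - a) / 2)) * cis ((t + a) / 2)"
    "cis t - cis a = 2 * \<i> * of_real (sin ((t - a) / 2)) * cis ((t + a) / 2)"
    using complex_add_cnj[of "cis ((t - a) / 2)"] complex_diff_cnj[of "cis ((t - a) / 2)"]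
    by (simp_all only: distrib_right[symmetric] left_diff_distrib[symmetric]) (simp_all add: mult_ac)
qed

lemma cis_eq_iff_sin_half: "cis t = cis a \<longleftrightarrow> sin ((t - a) / 2) = 0"
proof -
  have "cis t = cis a \<longleftrightarrow> cis t - cis a = 0"
    by simp
  then show ?thesis
    unfolding cis_add_diff_half_angle(2) by simp
qed

lemma herglotz_kernel_cis:
  assumes "sin ((t - a) / 2) \<noteq> 0"
  shows "(cis t + cis a) / (cis t - cis a) = - \<i> * of_real (cot ((t - a) / 2))"
  unfolding cis_add_diff_half_angle cot_def using assms
  by (simp add: field_simps)

text \<open>The inverse of the Cayley transform \<open>h \<mapsto> (h + 1) / (h - 1)\<close> is the transform itself, and it
  maps unimodular numbers to the imaginary axis because \<open>cnj v = 1 / v\<close>.\<close>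
lemma cayley_surj_circle:
  fixes v :: complex
  assumes "norm v = 1" "v \<noteq> 1"
  shows "\<exists>y::real. v = (\<i> * of_real y + 1) / (\<i> * of_real y - 1)"
proof -
  define h where "h = (v + 1) / (v - 1)"
  have "v * cnj v = 1"
    using assms(1) complex_norm_square[of v] by simp
  then have "cnj v = 1 / v"
    by (metis mult_eq_0_iff nonzero_mult_div_cancel_left zero_neq_one)
  moreover have "v \<noteq> 0" "v - 1 \<noteq> 0" "1 - v \<noteq> 0"
    using assms by auto
  ultimately have "cnj h = - h"
    unfolding h_def by (simp add: divide_simps) (simp add: algebra_simps)
  then have "Re h = 0"
    by (simp add: complex_eq_iff)
  then have "h = \<i> * of_real (Im h)"
    by (simp add: complex_eq_iff)
  moreover have "h - 1 \<noteq> 0" "v * (h - 1) = h + 1"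
    using \<open>v - 1 \<noteq> 0\<close> unfolding h_def by (simp_all add: field_simps)
  then have "v = (h + 1) / (h - 1)"
    by (simp add: field_simps)
  ultimately show ?thesis by metis
qed

lemma norm_blaschke_factor_circle:
  assumes "norm w = 1" "norm a < 1"
  shows "norm ((w - a) / (1 - cnj a * w)) = 1"
proof -
  have "norm (1 - cnj a * w) = norm (w - a)"
    using circle_mult_cnj_diff[OF assms(1), of a] assms(1)
    by (metis complex_mod_cnj mult_1 norm_mult)
  moreover have "w \<noteq> a"
    using assms by auto
  ultimately show ?thesis
    by (simp add: norm_divide)
qed

lemma sin_half_nonzero:
  fixes x :: real
  assumes "x \<noteq> 0" "\<bar>x\<bar> < 2 * pi"
  shows "sin (x / 2) \<noteq> 0"
proof (cases "x > 0")
  case True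
  then have "0 < sin (x / 2)"
    using assms by (intro sin_gt_zero) auto
  then show ?thesis by simp
next
  case False
  then have "0 < sin (- (x / 2))"
    using assms by (intro sin_gt_zero) auto
  then show ?thesis by simp
qed

text \<open>The Herglotz sum is singular at the initial point of the arc, which supplies the value 1; the
  other unimodular values come from the interior of the arc through the sum of cotangents.\<close>
lemma cayley_herglotz_image_arc:
  fixes \<theta> :: "nat \<Rightarrow> real"
  assumes \<theta>: "strict_mono_on {0..N} \<theta>" "\<theta> N = \<theta> 0 + 2 * pi" and k: "k < N" and "\<epsilon> > 0"
    and B: "\<And>w. norm w = 1 \<Longrightarrow> norm (B w) = 1"
      "\<And>w. norm w = 1 \<Longrightarrow> B w =
        (of_real \<epsilon> * poly (herglotz_poly (cis \<circ> \<theta>) {1..N}) w + poly (node_poly (cis \<circ> \<theta>) {1..N}) w) /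
        (of_real \<epsilon> * poly (herglotz_poly (cis \<circ> \<theta>) {1..N}) w - poly (node_poly (cis \<circ> \<theta>) {1..N}) w)"
  shows "B ` cis ` {\<theta> k..<\<theta> (Suc k)} = sphere 0 1"
proof (rule antisym)
  show "B ` cis ` {\<theta> k..<\<theta> (Suc k)} \<subseteq> sphere 0 1"
    using B(1) by auto
next
  have less: "\<theta> i < \<theta> j" if "i < j" "j \<le> N" for i j
    using strict_mono_onD[OF \<theta>(1), of i j] that by simp
  have le: "\<theta> i \<le> \<theta> j" if "i \<le> j" "j \<le> N" for i j
    using less[of i j] that by (cases "i = j") auto
  \<comment> \<open>The nodes are numbered from 1, so the initial point of the first arc, of argument
    \<open>\<theta> 0\<close>, is the node with number \<open>N\<close>.\<close>
  define p where "p = (if k = 0 then N else k)"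
  have p: "p \<in> {1..N}" "sin ((\<theta> k - \<theta> p) / 2) = 0"
    using k \<theta>(2) by (auto simp: p_def)
  have q: "Suc k \<in> {1..N}" "sin ((\<theta> (Suc k) - \<theta> (Suc k)) / 2) = 0"
    using k by auto
  have node_sin: "sin ((\<theta> i - \<theta> j) / 2) \<noteq> 0" if "i \<in> {1..N}" "j \<in> {1..N}" "i \<noteq> j" for i j
  proof (rule sin_half_nonzero)
    show "\<theta> i - \<theta> j \<noteq> 0"
      using less[of i j] less[of j i] that by (cases i j rule: linorder_cases) auto
    show "\<bar>\<theta> i - \<theta> j\<bar> < 2 * pi"
      using less[of 0 i] less[of 0 j] le[of i N] le[of j N] that \<theta>(2) by auto
  qed
  have cis_p: "cis (\<theta> k) = cis (\<theta> p)"
    using p(2) by (simp only: cis_eq_iff_sin_half)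
  have left: "sin ((\<theta> k - \<theta> j) / 2) \<noteq> 0" if "j \<in> {1..N} - {p}" for j
  proof -
    have "cis (\<theta> p) \<noteq> cis (\<theta> j)"
      using node_sin[of p j] p(1) that by (simp add: cis_eq_iff_sin_half)
    then show ?thesis
      unfolding cis_p[symmetric] by (simp add: cis_eq_iff_sin_half)
  qed
  have inside: "sin ((t - \<theta> j) / 2) \<noteq> 0" if t: "t \<in> {\<theta> k<..<\<theta> (Suc k)}" and j: "j \<in> {1..N}" for t j
  proof (rule sin_half_nonzero)
    show "t - \<theta> j \<noteq> 0"
      using le[of j k] le[of "Suc k" j] t j k by (cases "j \<le> k") auto
    show "\<bar>t - \<theta> j\<bar> < 2 * pi"
      using le[of 0 k] le[of "Suc k" N] less[of 0 j] le[of j N] t j k \<theta>(2) by auto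
  qed
  have inj: "inj_on (cis \<circ> \<theta>) {1..N}"
    using node_sin unfolding inj_on_def comp_def cis_eq_iff_sin_half by blast
  show "sphere 0 1 \<subseteq> B ` cis ` {\<theta> k..<\<theta> (Suc k)}"
  proof
    fix v :: complex assume "v \<in> sphere 0 1"
    then have v: "norm v = 1" by simp
    show "v \<in> B ` cis ` {\<theta> k..<\<theta> (Suc k)}"
    proof (cases "v = 1")
      case True
      have "poly (node_poly (cis \<circ> \<theta>) {1..N}) (cis (\<theta> k)) = 0"
        using poly_node_poly_node[of "{1..N}" p "cis \<circ> \<theta>"] p(1) cis_p by simp
      moreover have "poly (herglotz_poly (cis \<circ> \<theta>) {1..N}) (cis (\<theta> k)) \<noteq> 0"
        using poly_herglotz_poly_node[of "{1..N}" p "cis \<circ> \<theta>"] p(1) cis_p inj by simp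
      ultimately have "B (cis (\<theta> k)) = v"
        using B(2)[of "cis (\<theta> k)"] True \<open>\<epsilon> > 0\<close> by simp
      then show ?thesis
        using less[of k "Suc k"] k by (intro image_eqI[of _ B "cis (\<theta> k)"]) auto
    next
      case False
      then obtain y where y: "v = (\<i> * of_real y + 1) / (\<i> * of_real y - 1)"
        using cayley_surj_circle v by blast
      \<comment> \<open>The Herglotz sum is \<open>-\<i>\<close> times the sum of cotangents, and \<open>\<epsilon>\<close> times it has to be \<open>\<i> y\<close>.\<close>
      obtain t where t: "t \<in> {\<theta> k<..<\<theta> (Suc k)}" "(\<Sum>j\<in>{1..N}. cot ((t - \<theta> j) / 2)) = - y / \<epsilon>"
        using cot_sum_surj[where A = "{1..N}" and a = \<theta> and y = "- y / \<epsilon>", OF _ _ p left q node_sin inside]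
          less[of k "Suc k"] k q(1) by force
      define P where "P = poly (node_poly (cis \<circ> \<theta>) {1..N}) (cis t)"
      have notin: "cis t \<notin> (cis \<circ> \<theta>) ` {1..N}"
        using inside[OF t(1)] by (auto simp: cis_eq_iff_sin_half)
      then have P: "P \<noteq> 0"
        by (auto simp: P_def poly_node_poly)
      have "(\<Sum>j\<in>{1..N}. (cis t + cis (\<theta> j)) / (cis t - cis (\<theta> j))) =
          - \<i> * of_real (\<Sum>j\<in>{1..N}. cot ((t - \<theta> j) / 2))"
        using inside[OF t(1)]
        by (simp add: herglotz_kernel_cis sum_distrib_left sum_negf del: mult_minus_left)
      then have "of_real \<epsilon> * poly (herglotz_poly (cis \<circ> \<theta>) {1..N}) (cis t) = P * (\<i> * of_real y)"
        unfolding poly_herglotz_poly_eq[OF finite_atLeastAtMost notin] t(2) P_def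
        using \<open>\<epsilon> > 0\<close> by simp
      then have "B (cis t) = (P * (\<i> * of_real y) + P) / (P * (\<i> * of_real y) - P)"
        using B(2)[of "cis t"] by (simp add: P_def)
      also have "\<dots> = (P * (\<i> * of_real y + 1)) / (P * (\<i> * of_real y - 1))"
        by (simp add: algebra_simps)
      also have "\<dots> = v"
        unfolding y using P by simp
      finally show ?thesis
        using t(1) by (intro image_eqI[of _ B "cis t"]) auto
    qed
  qed
qed

section \<open>Separated zeros\<close>

text \<open>For \<open>\<bar>a\<bar> = 1\<close> one has \<open>1 - cnj b * a = a * cnj (a - b)\<close>, so at the limit points the quotient
  has modulus 1.\<close>
lemma tendsto_pseudohyperbolic_circle:
  assumes "(f \<longlongrightarrow> a) F" "(g \<longlongrightarrow> b) F" "norm a = 1" "norm b = 1" "a \<noteq> b"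
  shows "((\<lambda>x. norm ((f x - g x) / (1 - cnj (g x) * f x))) \<longlongrightarrow> 1) F"
proof -
  have eq: "a * cnj (a - b) = 1 - cnj b * a"
    using circle_mult_cnj_diff[OF assms(3)] .
  then have "1 - cnj b * a \<noteq> 0"
    using assms(3,5) by (metis complex_cnj_zero_iff eq_iff_diff_eq_0 mult_eq_0_iff norm_zero zero_neq_one)
  then have "((\<lambda>x. norm ((f x - g x) / (1 - cnj (g x) * f x))) \<longlongrightarrow>
      norm ((a - b) / (1 - cnj b * a))) F"
    using assms(1,2) by (intro tendsto_intros)
  moreover have "norm ((a - b) / (1 - cnj b * a)) = 1"
    unfolding eq[symmetric] using assms(3,5) by (simp add: norm_divide norm_mult flip: complex_cnj_diff)
  ultimately show ?thesis by simp
qed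

text \<open>The roots selected near the nodes have distinct limits, so they are eventually distinct, and
  each of the finitely many products in the separation constant tends to 1.\<close>
lemma ex_separated_roots:
  fixes \<zeta> :: "nat \<Rightarrow> complex"
  assumes "N \<ge> 1" "inj_on \<zeta> {1..N}" "\<And>j. j \<in> {1..N} \<Longrightarrow> norm (\<zeta> j) = 1" "C < 1"
  shows "\<exists>\<epsilon>>0. \<exists>z. inj_on z {1..N} \<and>
    (\<forall>j\<in>{1..N}. poly (perturbed_poly \<zeta> {1..N} \<epsilon>) (z j) = 0) \<and> separation_const N z > C"
proof -
  have "\<exists>z. \<forall>k\<in>{1..N}. (\<forall>\<epsilon>>0. poly (perturbed_poly \<zeta> {1..N} \<epsilon>) (z k \<epsilon>) = 0) \<and>
      (z k \<longlongrightarrow> \<zeta> k) (at_right 0)"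
    by (intro bchoice ballI tendsto_selected_roots) auto
  then obtain z where
    root: "\<And>k \<epsilon>. k \<in> {1..N} \<Longrightarrow> \<epsilon> > 0 \<Longrightarrow> poly (perturbed_poly \<zeta> {1..N} \<epsilon>) (z k \<epsilon>) = 0" and
    lim: "\<And>k. k \<in> {1..N} \<Longrightarrow> (z k \<longlongrightarrow> \<zeta> k) (at_right 0)"
    by blast
  have "\<forall>\<^sub>F \<epsilon> in at_right 0. z i \<epsilon> \<noteq> z j \<epsilon>" if "i \<in> {1..N}" "j \<in> {1..N}" "i \<noteq> j" for i j
  proof -
    have "((\<lambda>\<epsilon>. z i \<epsilon> - z j \<epsilon>) \<longlongrightarrow> \<zeta> i - \<zeta> j) (at_right 0)"
      using lim that by (intro tendsto_intros) auto
    moreover have "\<zeta> i - \<zeta> j \<noteq> 0"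
      using inj_on_eq_iff[OF assms(2)] that by simp
    ultimately have "\<forall>\<^sub>F \<epsilon> in at_right 0. z i \<epsilon> - z j \<epsilon> \<noteq> 0"
      by (rule tendsto_imp_eventually_ne)
    then show ?thesis by simp
  qed
  then have ev1: "\<forall>\<^sub>F \<epsilon> in at_right 0. \<forall>i\<in>{1..N}. \<forall>j\<in>{1..N} - {i}. z i \<epsilon> \<noteq> z j \<epsilon>"
    by (intro eventually_ball_finite ballI) auto
  have "\<forall>\<^sub>F \<epsilon> in at_right 0.
      C < (\<Prod>j\<in>{1..N} - {k}. norm ((z j \<epsilon> - z k \<epsilon>) / (1 - cnj (z k \<epsilon>) * z j \<epsilon>)))"
    if k: "k \<in> {1..N}" for k
  proof -
    have "((\<lambda>\<epsilon>. \<Prod>j\<in>{1..N} - {k}. norm ((z j \<epsilon> - z k \<epsilon>) / (1 - cnj (z k \<epsilon>) * z j \<epsilon>))) \<longlongrightarrow>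
        (\<Prod>j\<in>{1..N} - {k}. 1)) (at_right 0)"
    proof (intro tendsto_prod)
      fix j assume j: "j \<in> {1..N} - {k}"
      then have "\<zeta> j \<noteq> \<zeta> k"
        using inj_on_eq_iff[OF assms(2)] k by simp
      then show "((\<lambda>\<epsilon>. norm ((z j \<epsilon> - z k \<epsilon>) / (1 - cnj (z k \<epsilon>) * z j \<epsilon>))) \<longlongrightarrow> 1)
          (at_right 0)"
        using tendsto_pseudohyperbolic_circle[OF lim[of j] lim[of k]] assms(3) j k by simp
    qed
    then show ?thesis
      using assms(4) by (intro order_tendstoD(1)) auto
  qed
  then have ev2: "\<forall>\<^sub>F \<epsilon> in at_right 0. \<forall>k\<in>{1..N}.
      C < (\<Prod>j\<in>{1..N} - {k}. norm ((z j \<epsilon> - z k \<epsilon>) / (1 - cnj (z k \<epsilon>) * z j \<epsilon>)))"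
    by (intro eventually_ball_finite ballI) auto
  obtain \<epsilon> :: real where \<epsilon>: "\<epsilon> > 0" "\<forall>i\<in>{1..N}. \<forall>j\<in>{1..N} - {i}. z i \<epsilon> \<noteq> z j \<epsilon>"
    "\<forall>k\<in>{1..N}. C < (\<Prod>j\<in>{1..N} - {k}. norm ((z j \<epsilon> - z k \<epsilon>) / (1 - cnj (z k \<epsilon>) * z j \<epsilon>)))"
    using eventually_happens'[OF trivial_limit_at_right_real
        eventually_conj[OF eventually_at_right_less[of 0] eventually_conj[OF ev1 ev2]]] by blast
  have "separation_const N (\<lambda>j. z j \<epsilon>) > C"
    unfolding separation_const_def using \<epsilon>(3) assms(1) by (subst Min_gr_iff) auto
  moreover have "inj_on (\<lambda>j. z j \<epsilon>) {1..N}"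
    using \<epsilon>(2) by (auto simp: inj_on_def)
  ultimately show ?thesis
    using root \<epsilon>(1) by (intro exI[of _ \<epsilon>] conjI exI[of _ "\<lambda>j. z j \<epsilon>"]) auto
qed

theorem theorem1:
  fixes N :: nat and \<gamma> :: "nat \<Rightarrow> complex set" and C :: real
  assumes "N \<ge> 1"
    and "circle_arc_partition N \<gamma>"
    and "C < 1"
  shows "\<exists>B lam z. finite_blaschke N lam z B \<and> separation_const N z > C \<and>
    (\<forall>n\<in>{1..N}. B ` \<gamma> n = sphere 0 1)"
proof -
  obtain \<theta> :: "nat \<Rightarrow> real" where \<theta>: "strict_mono_on {0..N} \<theta>" "\<theta> N = \<theta> 0 + 2 * pi"
    and arcs: "\<gamma> ` {1..N} = (\<lambda>k. cis ` {\<theta> k..<\<theta> (Suc k)}) ` {..<N}"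
    using assms(2) unfolding circle_arc_partition_def by blast
  define \<zeta> where "\<zeta> = cis \<circ> \<theta>"
  have \<zeta>: "norm (\<zeta> j) = 1" for j
    by (simp add: \<zeta>_def)
  have inj: "inj_on \<zeta> {1..N}"
  proof (rule linorder_inj_onI')
    fix i j assume ij: "i \<in> {1..N}" "j \<in> {1..N}" "i < j"
    have "\<theta> i < \<theta> j" "\<theta> 0 < \<theta> i" "\<theta> j \<le> \<theta> N"
      using strict_mono_onD[OF \<theta>(1)] ij by (auto simp: strict_mono_on_leD[OF \<theta>(1)])
    then have "sin ((\<theta> i - \<theta> j) / 2) \<noteq> 0"
      using \<theta>(2) by (intro sin_half_nonzero) auto
    then show "\<zeta> i \<noteq> \<zeta> j"
      by (simp add: \<zeta>_def cis_eq_iff_sin_half)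
  qed
  obtain \<epsilon> z where "\<epsilon> > 0" and z: "inj_on z {1..N}"
      "\<And>j. j \<in> {1..N} \<Longrightarrow> poly (perturbed_poly \<zeta> {1..N} \<epsilon>) (z j) = 0"
      "separation_const N z > C"
    using ex_separated_roots[OF assms(1) inj \<zeta> assms(3)] by blast
  have disc: "norm (z j) < 1" if "j \<in> {1..N}" for j
    using roots_perturbed_poly_in_disc[OF _ inj \<zeta> \<open>\<epsilon> > 0\<close> z(2)[OF that]] by simp
  define lam where "lam = - (\<Prod>j\<in>{1..N}. - cnj (\<zeta> j))"
  define B where "B = (\<lambda>w. lam * (\<Prod>n=1..N. (w - z n) / (1 - cnj (z n) * w)))"
  have lam: "norm lam = 1"
    using \<zeta> by (simp add: lam_def norm_mult prod_norm[symmetric])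
  have "norm (B w) = 1" if "norm w = 1" for w
  proof -
    have "(\<Prod>n=1..N. norm ((w - z n) / (1 - cnj (z n) * w))) = 1"
      using norm_blaschke_factor_circle[OF that disc] by (intro prod.neutral) blast
    then show ?thesis
      unfolding B_def norm_mult lam by (simp only: prod_norm mult_1)
  qed
  moreover have "B w = (of_real \<epsilon> * poly (herglotz_poly \<zeta> {1..N}) w + poly (node_poly \<zeta> {1..N}) w) /
      (of_real \<epsilon> * poly (herglotz_poly \<zeta> {1..N}) w - poly (node_poly \<zeta> {1..N}) w)"
    if "norm w = 1" for w
    unfolding B_def lam_def using \<zeta> \<open>\<epsilon> > 0\<close> disc z that
    by (intro blaschke_eq_cayley_herglotz(2)) auto
  ultimately have "B ` cis ` {\<theta> k..<\<theta> (Suc k)} = sphere 0 1" if "k < N" for k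
    using cayley_herglotz_image_arc[OF \<theta> that \<open>\<epsilon> > 0\<close>, of B] unfolding \<zeta>_def by blast
  then have "B ` \<gamma> n = sphere 0 1" if "n \<in> {1..N}" for n
    using arcs that by (metis (no_types, lifting) image_iff lessThan_iff)
  moreover have "finite_blaschke N lam z B"
    unfolding finite_blaschke_def B_def using lam disc by simp
  ultimately show ?thesis
    using z(3) by blast
qed

end
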